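(* Let $R$ be a ring, $E=(E^0,E^1,\mathbf{s},\mathbf{r})$ a graph, and $\delta : G_E \to R$ a map that preserves zero. Then $\delta$ is central if and only if the following conditions hold. (1) If $\delta (x) \neq 0$ for some $x \in G_E$, then either $x=pqp^*$ or $x=pq^*p^*$ for some $p \in \mathrm{Path}(E)$ and $q \in \mathrm{ClPath}(E)$. (2) For all $p \in \mathrm{Path}(E)$ and $q \in \mathrm{ClPath}(E)$ with $\mathbf{r}(p)=\mathbf{s}(q)$, we have $\delta(pqp^* )=\delta(q)$ and $\delta(pq^*p^* )=\delta(q^* )$. (3) For all $p,q \in \mathrm{ClPath}(E)$ such that $p \approx q$, we have $\delta (p) = \delta (q)$ and $\delta (p^* ) = \delta (q^* )$.
   Context: Rings are associative but not necessarily unital. A graph $E=(E^0,E^1,\mathbf{s},\mathbf{r})$ consists of sets $E^0$ (vertices) and $E^1$ (edges) and maps $\mathbf{s},\mathbf{r}:E^1\to E^0$ (source and range). A path is a finite sequence $p=e_1\cdots e_n$ of edges with $\mathbf{r}(e_i)=\mathbf{s}(e_{i+1})$ for $1\le i<n$; $\mathbf{s}(p)=\mathbf{s}(e_1)$, $\mathbf{r}(p)=\mathbf{r}(e_n)$. Vertices $v$ are regarded as paths of length $0$ with $\mathbf{s}(v)=\mathbf{r}(v)=v$. $\mathrm{Path}(E)$ is the set of all paths, and $\mathrm{ClPath}(E)$ the set of closed paths, i.e., those $p\in \mathrm{Path}(E)$ with $\mathbf{s}(p)=\mathbf{r}(p)$ (including vertices). For $p,q\in\mathrm{ClPath}(E)$,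 $p\approx q$ means that there are $x,y\in\mathrm{Path}(E)$ with $p=xy$ and $yx=q$. The graph inverse semigroup $G_E$ is the semigroup with zero generated by $E^0$, $E^1$ and symbols $\{e^*\mid e\in E^1\}$, subject to, for all $v,w\in E^0$, $e,f\in E^1$: $vw=\delta_{v,w}v$; $\mathbf{s}(e)e=e\mathbf{r}(e)=e$; $\mathbf{r}(e)e^*=e^*\mathbf{s}(e)=e^*$; $e^*f=\delta_{e,f}\mathbf{r}(e)$ (here $\delta_{\cdot,\cdot}$ is the Kronecker delta). Set $v^*:=v$ for $v\in E^0$ and $(e_1\cdots e_n)^*:=e_n^*\cdots e_1^*$. Every nonzero element of $G_E$ is uniquely $pq^*$ with $p,q\in\mathrm{Path}(E)$, $\mathbf{r}(p)=\mathbf{r}(q)$. A map $\delta:G_E\to R$ preserves zero if $\delta(0)=0$, and is central if $\delta(gh)=\delta(hg)$ for all $g,h\in G_E$. *)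

theory Defs
  imports "Graph_Theory.Arc_Walk"
begin

subsection \<open>Paths in a graph\<close>

text \<open>
  A path is a pair of its source vertex and its list of edges; a vertex \<open>v\<close>, regarded as
  a path of length \<open>0\<close>, is \<open>(v, [])\<close>.  Graphs are arbitrary directed multigraphs
  (\<open>wf_digraph\<close>), with no finiteness condition.
\<close>

type_synonym ('v, 'e) path = "'v \<times> 'e list"

definition Path :: "('v, 'e) pre_digraph \<Rightarrow> ('v, 'e) path set" where
  "Path E = {(u, es) | u es v. pre_digraph.awalk E u es v}"

definition path_source :: "('v, 'e) path \<Rightarrow> 'v" where
  "path_source p = fst p"

definition path_range :: "('v, 'e) pre_digraph \<Rightarrow> ('v, 'e) path \<Rightarrow> 'v" where
  "path_range E p = pre_digraph.awlast E (fst p) (snd p)"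

definition ClPath :: "('v, 'e) pre_digraph \<Rightarrow> ('v, 'e) path set" where
  "ClPath E = {p \<in> Path E. path_source p = path_range E p}"

text \<open>The concatenation is meaningful only if the range of \<open>p\<close> is the source of \<open>q\<close>.\<close>

definition path_concat :: "('v, 'e) path \<Rightarrow> ('v, 'e) path \<Rightarrow> ('v, 'e) path" where
  "path_concat p q = (fst p, snd p @ snd q)"

definition cl_equiv :: "('v, 'e) pre_digraph \<Rightarrow> ('v, 'e) path \<Rightarrow> ('v, 'e) path \<Rightarrow> bool" where
  "cl_equiv E p q \<longleftrightarrow>
     (\<exists>x \<in> Path E. \<exists>y \<in> Path E.
        path_range E x = path_source y \<and> path_range E y = path_source x \<and>
        p = path_concat x y \<and> path_concat y x = q)"


subsection \<open>The graph inverse semigroup\<close>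

text \<open>
  The semigroup is given by its presentation: the free semigroup with zero on the generators
  consists of the nonempty words in the generators (as \<open>Some w\<close>) and the zero element
  (\<open>None\<close>), and we divide by the least congruence containing the defining relations.
\<close>

datatype ('v, 'e) gis_gen = Vertex 'v | Edge 'e | Ghost 'e

type_synonym ('v, 'e) gis_word = "('v, 'e) gis_gen list option"

definition gis_gens :: "('v, 'e) pre_digraph \<Rightarrow> ('v, 'e) gis_gen set" where
  "gis_gens E = Vertex ` verts E \<union> Edge ` arcs E \<union> Ghost ` arcs E"

definition gis_free :: "('v, 'e) pre_digraph \<Rightarrow> ('v, 'e) gis_word set" where
  "gis_free E = insert None (Some ` {w. w \<noteq> [] \<and> set w \<subseteq> gis_gens E})"

fun word_mult :: "('v, 'e) gis_word \<Rightarrow> ('v, 'e) gis_word \<Rightarrow> ('v, 'e) gis_word" where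
  "word_mult (Some a) (Some b) = Some (a @ b)"
| "word_mult _ _ = None"

inductive_set gis_cong :: "('v, 'e) pre_digraph \<Rightarrow> ('v, 'e) gis_word rel"
  for E :: "('v, 'e) pre_digraph" where
  vert_vert: "\<lbrakk>v \<in> verts E; w \<in> verts E\<rbrakk> \<Longrightarrow>
     (Some [Vertex v, Vertex w], if v = w then Some [Vertex v] else None) \<in> gis_cong E"
| source_edge: "e \<in> arcs E \<Longrightarrow> (Some [Vertex (tail E e), Edge e], Some [Edge e]) \<in> gis_cong E"
| edge_range: "e \<in> arcs E \<Longrightarrow> (Some [Edge e, Vertex (head E e)], Some [Edge e]) \<in> gis_cong E"
| range_ghost: "e \<in> arcs E \<Longrightarrow> (Some [Vertex (head E e), Ghost e], Some [Ghost e]) \<in> gis_cong E"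
| ghost_source: "e \<in> arcs E \<Longrightarrow> (Some [Ghost e, Vertex (tail E e)], Some [Ghost e]) \<in> gis_cong E"
| ghost_edge: "\<lbrakk>e \<in> arcs E; f \<in> arcs E\<rbrakk> \<Longrightarrow>
     (Some [Ghost e, Edge f], if e = f then Some [Vertex (head E e)] else None) \<in> gis_cong E"
| refl: "a \<in> gis_free E \<Longrightarrow> (a, a) \<in> gis_cong E"
| sym: "(a, b) \<in> gis_cong E \<Longrightarrow> (b, a) \<in> gis_cong E"
| trans: "\<lbrakk>(a, b) \<in> gis_cong E; (b, c) \<in> gis_cong E\<rbrakk> \<Longrightarrow> (a, c) \<in> gis_cong E"
| mult: "\<lbrakk>(a, b) \<in> gis_cong E; (c, d) \<in> gis_cong E\<rbrakk> \<Longrightarrow>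
     (word_mult a c, word_mult b d) \<in> gis_cong E"

type_synonym ('v, 'e) gis_elem = "('v, 'e) gis_word set"

definition gis :: "('v, 'e) pre_digraph \<Rightarrow> ('v, 'e) gis_elem set" where
  "gis E = gis_free E // gis_cong E"

definition gis_class :: "('v, 'e) pre_digraph \<Rightarrow> ('v, 'e) gis_word \<Rightarrow> ('v, 'e) gis_elem" where
  "gis_class E a = gis_cong E `` {a}"

definition gis_zero :: "('v, 'e) pre_digraph \<Rightarrow> ('v, 'e) gis_elem" where
  "gis_zero E = gis_class E None"

definition gis_mult ::
  "('v, 'e) pre_digraph \<Rightarrow> ('v, 'e) gis_elem \<Rightarrow> ('v, 'e) gis_elem \<Rightarrow> ('v, 'e) gis_elem" where
  "gis_mult E g h = (\<Union>a \<in> g. \<Union>b \<in> h. gis_class E (word_mult a b))"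

definition gis_path :: "('v, 'e) pre_digraph \<Rightarrow> ('v, 'e) path \<Rightarrow> ('v, 'e) gis_elem" where
  "gis_path E p =
     gis_class E (Some (if snd p = [] then [Vertex (fst p)] else map Edge (snd p)))"

definition gis_star :: "('v, 'e) pre_digraph \<Rightarrow> ('v, 'e) path \<Rightarrow> ('v, 'e) gis_elem" where
  "gis_star E p =
     gis_class E (Some (if snd p = [] then [Vertex (fst p)] else map Ghost (rev (snd p))))"


subsection \<open>Well-definedness\<close>

lemma word_mult_free:
  "a \<in> gis_free E \<Longrightarrow> b \<in> gis_free E \<Longrightarrow> word_mult a b \<in> gis_free E"
  by (cases a; cases b) (auto simp: gis_free_def)

lemma gis_cong_free:
  assumes "wf_digraph E" and "(a, b) \<in> gis_cong E"
  shows "a \<in> gis_free E \<and> b \<in> gis_free E"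
  using assms(2)
proof induction
  case (mult a b c d)
  then show ?case by (simp add: word_mult_free)
qed (use assms(1) in \<open>auto simp: gis_free_def gis_gens_def wf_digraph_def\<close>)

lemma equiv_gis_cong:
  assumes "wf_digraph E"
  shows "equiv (gis_free E) (gis_cong E)"
proof (rule equivI)
  show "gis_cong E \<subseteq> gis_free E \<times> gis_free E" using gis_cong_free[OF assms] by auto
  show "refl_on (gis_free E) (gis_cong E)" by (auto simp: refl_on_def intro: gis_cong.refl)
  show "Relation.sym (gis_cong E)" by (auto simp: sym_def intro: gis_cong.sym)
  show "Relation.trans (gis_cong E)" by (auto simp: trans_def intro: gis_cong.trans)
qed

lemma gis_mult_class:
  assumes "wf_digraph E" and "a \<in> gis_free E" and "b \<in> gis_free E"
  shows "gis_mult E (gis_class E a) (gis_class E b) = gis_class E (word_mult a b)"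
proof -
  have eq: "gis_class E (word_mult a' b') = gis_class E (word_mult a b)"
    if "a' \<in> gis_class E a" "b' \<in> gis_class E b" for a' b'
  proof -
    have "(word_mult a b, word_mult a' b') \<in> gis_cong E"
      using that by (intro gis_cong.mult) (simp_all add: gis_class_def)
    from equiv_class_eq[OF equiv_gis_cong[OF assms(1)] this] show ?thesis
      by (simp add: gis_class_def)
  qed
  have "a \<in> gis_class E a" "b \<in> gis_class E b"
    using assms(2,3) by (simp_all add: gis_class_def gis_cong.refl)
  then have "gis_class E a \<noteq> {}" "gis_class E b \<noteq> {}" by auto
  then show ?thesis by (simp add: gis_mult_def eq)
qed


subsection \<open>Maps on the graph inverse semigroup\<close>

text \<open>Only the values of the map on the carrier \<open>gis E\<close> matter.\<close>

definition preserves_zero ::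
  "('v, 'e) pre_digraph \<Rightarrow> (('v, 'e) gis_elem \<Rightarrow> 'r::ring) \<Rightarrow> bool" where
  "preserves_zero E \<delta> \<longleftrightarrow> \<delta> (gis_zero E) = 0"

definition central_map ::
  "('v, 'e) pre_digraph \<Rightarrow> (('v, 'e) gis_elem \<Rightarrow> 'r::ring) \<Rightarrow> bool" where
  "central_map E \<delta> \<longleftrightarrow> (\<forall>g \<in> gis E. \<forall>h \<in> gis E. \<delta> (gis_mult E g h) = \<delta> (gis_mult E h g))"

end

theory Submission
  imports Defs
begin

text \<open>
  \<open>G\<^sub>E\<close> acts on pairs (vertex, list of edges) by partial maps, \<open>p q\<^sup>*\<close> acting as
  \<open>q x \<mapsto> p x\<close>. Rewriting brings every word into the form \<open>0\<close> or \<open>p q\<^sup>*\<close>, and the action separates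
  these, so the normal form is unique and products can be computed as compositions of partial maps.

  If \<open>\<delta>\<close> is central and \<open>\<delta>(p q\<^sup>*) \<noteq> 0\<close>, then \<open>q\<^sup>* p \<noteq> 0\<close>, so one of \<open>p\<close>, \<open>q\<close> is a prefix of
  the other; this gives (1), while (2) and (3) are instances of \<open>\<delta>(g h) = \<delta>(h g)\<close>. Conversely, take
  \<open>g = a b\<^sup>*\<close> and \<open>h = c d\<^sup>*\<close> with \<open>\<delta>(g h) \<noteq> 0\<close>. Then \<open>b\<close> and \<open>c\<close> are comparable, and
  by (1) and uniqueness of normal forms \<open>g h\<close> is a conjugate of some closed path \<open>k\<close> or of \<open>k\<^sup>*\<close>;
  in each case \<open>h g\<close> is a conjugate of a rotation of \<open>k\<close> or of its star.
\<close>

section \<open>Prefix replacement as a partial map\<close>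

definition prefix_swap :: "('v, 'e) path \<Rightarrow> ('v, 'e) path \<Rightarrow> ('v, 'e) path \<rightharpoonup> ('v, 'e) path" where
  "prefix_swap p q = (\<lambda>(v, y).
     if v = fst q \<and> take (length (snd q)) y = snd q
     then Some (fst p, snd p @ drop (length (snd q)) y) else None)"

lemma prefix_swap_eq_Some_iff:
  "prefix_swap p q z = Some z' \<longleftrightarrow> (\<exists>x. z = (fst q, snd q @ x) \<and> z' = (fst p, snd p @ x))"
proof -
  have "take (length b) y = b \<longleftrightarrow> (\<exists>x. y = b @ x)" for b y :: "'b list"
    by (metis append_eq_conv_conj append_take_drop_id)
  then show ?thesis by (cases z) (auto simp: prefix_swap_def)
qed

text \<open>The map sends \<open>q\<close> to \<open>p\<close>. If two such maps agree, evaluating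
  each at the other's \<open>q\<close> shows that \<open>q\<close> and \<open>q'\<close> are
  prefixes of one another, hence equal, and then so are \<open>p\<close> and
  \<open>p'\<close>.\<close>

lemma prefix_swap_inject:
  assumes "prefix_swap p q = prefix_swap p' q'"
  shows "p = p' \<and> q = q'"
proof -
  have *: "prefix_swap p q q = Some p" for p q :: "('a, 'b) path"
    by (simp add: prefix_swap_eq_Some_iff prod_eq_iff)
  have "prefix_swap p' q' q = Some p" "prefix_swap p q q' = Some p'"
    using *[of p q] *[of p' q'] assms by simp_all
  then show ?thesis by (auto simp: prefix_swap_eq_Some_iff prod_eq_iff)
qed

lemma prefix_swap_nonempty: "prefix_swap p q \<noteq> Map.empty"
proof -
  have "prefix_swap p q q = Some p" by (simp add: prefix_swap_eq_Some_iff prod_eq_iff)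
  then show ?thesis by auto
qed

lemma map_eqI_Some: "(\<And>x y. f x = Some y \<longleftrightarrow> g x = Some y) \<Longrightarrow> f = g"
  by (rule ext) (metis option.exhaust)

lemma prefix_swap_comp_left:
  "prefix_swap p q \<circ>\<^sub>m prefix_swap (path_concat q t) s = prefix_swap (path_concat p t) s"
  by (rule map_eqI_Some) (auto simp: map_comp_Some_iff prefix_swap_eq_Some_iff path_concat_def)

lemma prefix_swap_comp_right:
  "prefix_swap p (path_concat q t) \<circ>\<^sub>m prefix_swap q s = prefix_swap p (path_concat s t)"
  by (rule map_eqI_Some) (auto simp: map_comp_Some_iff prefix_swap_eq_Some_iff path_concat_def)

text \<open>A point of the domain is carried by the map applied first to a list that begins with
  both \<open>snd p'\<close> and \<open>snd q\<close>, and two prefixes of one list are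
  comparable.\<close>

lemma prefix_swap_comp_nonempty:
  assumes "prefix_swap p q \<circ>\<^sub>m prefix_swap p' q' \<noteq> Map.empty"
  shows "fst q = fst p' \<and> (\<exists>t. snd p' = snd q @ t \<or> snd q = snd p' @ t)"
proof -
  obtain z z' where "(prefix_swap p q \<circ>\<^sub>m prefix_swap p' q') z = Some z'"
    using assms by (auto simp: fun_eq_iff)
  then obtain x y where "fst p' = fst q" "snd p' @ x = snd q @ y"
    unfolding map_comp_Some_iff prefix_swap_eq_Some_iff by (metis prod.inject)
  then show ?thesis by (metis append_eq_append_conv2)
qed

section \<open>The action of generators and words\<close>

text \<open>The pairs need not be walks, so a ghost edge checks the base vertex as well as the first
  edge; otherwise \<open>ghost_source\<close> would fail for the action.\<close>

fun gen_act :: "('v, 'e) pre_digraph \<Rightarrow> ('v, 'e) gis_gen \<Rightarrow> ('v, 'e) path \<rightharpoonup> ('v, 'e) path" where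
  "gen_act E (Vertex v) (u, y) = (if u = v then Some (u, y) else None)"
| "gen_act E (Edge e) (u, y) = (if u = head E e then Some (tail E e, e # y) else None)"
| "gen_act E (Ghost e) (u, []) = None"
| "gen_act E (Ghost e) (u, f # y) = (if f = e \<and> u = tail E e then Some (head E e, y) else None)"

definition list_act ::
  "('v, 'e) pre_digraph \<Rightarrow> ('v, 'e) gis_gen list \<Rightarrow> ('v, 'e) path \<rightharpoonup> ('v, 'e) path" where
  "list_act E w = foldr (\<lambda>g f. gen_act E g \<circ>\<^sub>m f) w Some"

fun word_act :: "('v, 'e) pre_digraph \<Rightarrow> ('v, 'e) gis_word \<Rightarrow> ('v, 'e) path \<rightharpoonup> ('v, 'e) path" where
  "word_act E None = Map.empty"
| "word_act E (Some w) = list_act E w"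

lemma list_act_Nil [simp]: "list_act E [] = Some"
  and list_act_Cons [simp]: "list_act E (g # w) = gen_act E g \<circ>\<^sub>m list_act E w"
  by (simp_all add: list_act_def)

lemma map_comp_Some_left [simp]: "Some \<circ>\<^sub>m f = f"
  and map_comp_Some_right [simp]: "f \<circ>\<^sub>m Some = f"
  by (auto simp: map_comp_def split: option.splits)

lemma map_comp_assoc: "(f \<circ>\<^sub>m g) \<circ>\<^sub>m h = f \<circ>\<^sub>m (g \<circ>\<^sub>m h)"
  by (auto simp: map_comp_def fun_eq_iff split: option.splits)

lemma list_act_append: "list_act E (a @ b) = list_act E a \<circ>\<^sub>m list_act E b"
  by (induction a) (simp_all add: map_comp_assoc)

lemma word_act_mult: "word_act E (word_mult a b) = word_act E a \<circ>\<^sub>m word_act E b"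
  by (cases a; cases b) (simp_all add: list_act_append)

text \<open>Every defining relation holds between the corresponding partial maps, and composition
  respects equality, so the action descends to \<open>G\<^sub>E\<close>. This invariant is what
  keeps normal forms apart.\<close>

lemma gis_cong_word_act:
  assumes "(a, b) \<in> gis_cong E"
  shows "word_act E a = word_act E b"
  using assms
proof induction
  case (ghost_source e)
  have "gen_act E (Ghost e) \<circ>\<^sub>m gen_act E (Vertex (tail E e)) = gen_act E (Ghost e)"
  proof
    fix z
    show "(gen_act E (Ghost e) \<circ>\<^sub>m gen_act E (Vertex (tail E e))) z = gen_act E (Ghost e) z"
      by (cases "(E, Ghost e :: ('a, 'b) gis_gen, z)" rule: gen_act.cases) (auto simp: map_comp_def)
  qed
  then show ?case by simp
next
  case (range_ghost e)
  have "gen_act E (Vertex (head E e)) \<circ>\<^sub>m gen_act E (Ghost e) = gen_act E (Ghost e)"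
  proof
    fix z
    show "(gen_act E (Vertex (head E e)) \<circ>\<^sub>m gen_act E (Ghost e)) z = gen_act E (Ghost e) z"
      by (cases "(E, Ghost e :: ('a, 'b) gis_gen, z)" rule: gen_act.cases) (auto simp: map_comp_def)
  qed
  then show ?case by simp
qed (auto simp: word_act_mult map_comp_def split: option.splits)

section \<open>Normal words and the congruence in a fixed graph\<close>

text \<open>
  The word of \<open>p q\<^sup>*\<close> for \<open>p = (u, es)\<close> and \<open>q = (v, ds)\<close> with equal ranges; \<open>v\<close> need not be recorded,
  since \<open>ds\<close> and the range determine it.
\<close>

definition normal_word :: "'v \<Rightarrow> 'e list \<Rightarrow> 'e list \<Rightarrow> ('v, 'e) gis_gen list" where
  "normal_word u es ds = Vertex u # map Edge es @ map Ghost (rev ds)"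

text \<open>Stands for \<open>p q\<^sup>*\<close> when the ranges agree. The arguments mirror those
  of \<open>prefix_swap\<close>, the map by which this element acts.\<close>

definition gis_nf ::
  "('v, 'e) pre_digraph \<Rightarrow> ('v, 'e) path \<Rightarrow> ('v, 'e) path \<Rightarrow> ('v, 'e) gis_elem" where
  "gis_nf E p q = gis_class E (Some (normal_word (fst p) (snd p) (snd q)))"

context wf_digraph
begin

lemma mem_Path_iff: "p \<in> Path G \<longleftrightarrow> awalk (fst p) (snd p) (path_range G p)"
  unfolding Path_def path_range_def by (cases p) (auto simp: awalk_def)

lemma PathD: "p \<in> Path G \<Longrightarrow> awalk (fst p) (snd p) (path_range G p)"
  by (simp add: mem_Path_iff)

lemma PathI: "awalk u es v \<Longrightarrow> (u, es) \<in> Path G"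
  by (auto simp: Path_def)

lemma path_range_eq: "awalk u es v \<Longrightarrow> path_range G (u, es) = v"
  by (auto simp: path_range_def)

lemma path_concat_Path:
  assumes "p \<in> Path G" "q \<in> Path G" "path_range G p = fst q"
  shows "path_concat p q \<in> Path G" "path_range G (path_concat p q) = path_range G q"
proof -
  have "awalk (fst p) (snd p @ snd q) (path_range G q)"
    using PathD[OF assms(1)] PathD[OF assms(2)] assms(3) by simp
  then show "path_concat p q \<in> Path G" "path_range G (path_concat p q) = path_range G q"
    by (auto simp: path_concat_def intro: PathI path_range_eq)
qed

lemma vertex_Path:
  assumes "v \<in> verts G"
  shows "(v, []) \<in> Path G" "path_range G (v, []) = v"
  using assms by (auto simp: PathI path_range_eq awalk_Nil_iff)

lemma path_range_verts: "p \<in> Path G \<Longrightarrow> path_range G p \<in> verts G"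
  using PathD by blast

text \<open>The free semigroup has no empty word, so \<open>mult\<close> covers only nonempty
  contexts. With the empty one added, relations can be applied inside words whose remainder may be
  empty.\<close>

lemma gis_cong_right:
  assumes "(a, b) \<in> gis_cong G" "set y \<subseteq> gis_gens G"
  shows "(word_mult a (Some y), word_mult b (Some y)) \<in> gis_cong G"
proof (cases "y = []")
  case True
  have "word_mult c (Some []) = c" for c :: "('a, 'b) gis_word" by (cases c) auto
  then show ?thesis using True assms(1) by simp
next
  case False
  then show ?thesis using assms by (intro gis_cong.mult gis_cong.refl) (auto simp: gis_free_def)
qed

lemma gis_cong_left:
  assumes "(a, b) \<in> gis_cong G" "set x \<subseteq> gis_gens G"
  shows "(word_mult (Some x) a, word_mult (Some x) b) \<in> gis_cong G"
proof (cases "x = []")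
  case True
  have "word_mult (Some []) c = c" for c :: "('a, 'b) gis_word" by (cases c) auto
  then show ?thesis using True assms(1) by simp
next
  case False
  then show ?thesis using assms by (intro gis_cong.mult gis_cong.refl) (auto simp: gis_free_def)
qed

lemma gen_in_gens [simp]:
  "Vertex v \<in> gis_gens G \<longleftrightarrow> v \<in> verts G"
  "Edge e \<in> gis_gens G \<longleftrightarrow> e \<in> arcs G"
  "Ghost e \<in> gis_gens G \<longleftrightarrow> e \<in> arcs G"
  by (auto simp: gis_gens_def)

lemma Some_gis_free [simp]: "Some w \<in> gis_free G \<longleftrightarrow> w \<noteq> [] \<and> set w \<subseteq> gis_gens G"
  by (auto simp: gis_free_def)

lemma normal_word_gens:
  assumes "awalk u es r" "awalk v ds r"
  shows "set (normal_word u es ds) \<subseteq> gis_gens G"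
  using assms by (auto simp: normal_word_def awalk_def)

section \<open>Reduction of words to normal form\<close>

definition has_normal_form :: "('a, 'b) gis_gen list \<Rightarrow> bool" where
  "has_normal_form w \<longleftrightarrow> (Some w, None) \<in> gis_cong G \<or>
     (\<exists>u es v ds r. awalk u es r \<and> awalk v ds r \<and>
        (Some w, Some (normal_word u es ds)) \<in> gis_cong G)"

lemma has_normal_formI:
  assumes "(Some w, Some (normal_word u es ds)) \<in> gis_cong G" "awalk u es r" "awalk v ds r"
  shows "has_normal_form w"
  using assms unfolding has_normal_form_def by blast

lemma has_normal_form_zeroI: "(Some w, None) \<in> gis_cong G \<Longrightarrow> has_normal_form w"
  by (simp add: has_normal_form_def)

lemma has_normal_form_trans:
  assumes "(Some w, Some w') \<in> gis_cong G" "has_normal_form w'"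
  shows "has_normal_form w"
  using assms unfolding has_normal_form_def by (meson gis_cong.trans)

text \<open>A vertex in front is absorbed, an edge lengthens \<open>es\<close>, and a ghost edge
  cancels the first edge of \<open>es\<close> or, if there is none, lengthens \<open>ds\<close>;
  every mismatch gives zero.\<close>

lemma has_normal_form_Cons:
  assumes g: "g \<in> gis_gens G" and w: "awalk u es r" "awalk v ds r"
  shows "has_normal_form (g # normal_word u es ds)"
proof -
  define z :: "('a, 'b) gis_gen list" where "z = map Edge es @ map Ghost (rev ds)"
  have nw: "normal_word u es ds = Vertex u # z" by (simp add: normal_word_def z_def)
  have zg: "set z \<subseteq> gis_gens G" and u: "u \<in> verts G"
    using normal_word_gens[OF w] by (auto simp: nw)
  note right = gis_cong_right[OF _ zg]
  show ?thesis
  proof (cases g)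
    case (Vertex x)
    then have "(Some (g # normal_word u es ds), if x = u then Some (normal_word u es ds) else None)
        \<in> gis_cong G"
      using right[OF gis_cong.vert_vert[of x _ u]] g u by (auto simp: nw)
    then show ?thesis using w by (cases "x = u") (auto intro: has_normal_formI has_normal_form_zeroI)
  next
    case (Edge e)
    then have e: "e \<in> arcs G" using g by simp
    \<comment> \<open>The range vertex of \<open>e\<close> is inserted after \<open>e\<close>. It
      meets \<open>Vertex u\<close>, so either the two merge or the whole word is zero.\<close>
    have 1: "(Some (Edge e # Vertex (head G e) # Vertex u # z), Some (Edge e # Vertex u # z)) \<in> gis_cong G"
      using gis_cong_right[OF gis_cong.edge_range[OF e], of "Vertex u # z"] zg u by simp
    have 2: "(Some (Edge e # Vertex (head G e) # Vertex u # z),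
        if head G e = u then Some (Edge e # Vertex (head G e) # z) else None) \<in> gis_cong G"
      using gis_cong_left[OF right[OF gis_cong.vert_vert[of "head G e" _ u]], of "[Edge e]"] e u
      by (auto split: if_splits)
    show ?thesis
    proof (cases "head G e = u")
      case True
      have "(Some (Edge e # Vertex (head G e) # z), Some (Edge e # z)) \<in> gis_cong G"
        using right[OF gis_cong.edge_range[OF e]] by simp
      moreover have "(Some (Edge e # z), Some (Vertex (tail G e) # Edge e # z)) \<in> gis_cong G"
        using right[OF gis_cong.source_edge[OF e]] by (simp add: gis_cong.sym)
      ultimately have "(Some (g # normal_word u es ds), Some (normal_word (tail G e) (e # es) ds)) \<in> gis_cong G"
        using True by (auto simp: nw Edge normal_word_def z_def intro: gis_cong.trans)
      then show ?thesis using w True e by (auto intro!: has_normal_formI simp: awalk_Cons_iff)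
    next
      case False
      then show ?thesis using 1 2
        by (auto simp: nw Edge intro!: has_normal_form_zeroI intro: gis_cong.trans gis_cong.sym)
    qed
  next
    case (Ghost e)
    then have e: "e \<in> arcs G" using g by simp
    \<comment> \<open>For a ghost edge the inserted vertex is the source of \<open>e\<close>, where
      \<open>e\<^sup>*\<close> ends.\<close>
    have 1: "(Some (Ghost e # Vertex (tail G e) # Vertex u # z), Some (Ghost e # Vertex u # z)) \<in> gis_cong G"
      using gis_cong_right[OF gis_cong.ghost_source[OF e], of "Vertex u # z"] zg u by simp
    have 2: "(Some (Ghost e # Vertex (tail G e) # Vertex u # z),
        if tail G e = u then Some (Ghost e # Vertex (tail G e) # z) else None) \<in> gis_cong G"
      using gis_cong_left[OF right[OF gis_cong.vert_vert[of "tail G e" _ u]], of "[Ghost e]"] e u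
      by (auto split: if_splits)
    show ?thesis
    proof (cases "tail G e = u")
      case True
      have "(Some (Ghost e # Vertex (tail G e) # z), Some (Ghost e # z)) \<in> gis_cong G"
        using right[OF gis_cong.ghost_source[OF e]] by simp
      then have 3: "(Some (g # normal_word u es ds), Some (Ghost e # z)) \<in> gis_cong G"
        using True by (simp add: nw Ghost)
      show ?thesis
      proof (cases es)
        case Nil
        have "(Some (Ghost e # z), Some (Vertex (head G e) # Ghost e # z)) \<in> gis_cong G"
          using right[OF gis_cong.range_ghost[OF e]] by (simp add: gis_cong.sym)
        \<comment> \<open>The word lists \<open>ds\<close> in reverse, so a ghost edge in front
          becomes the last edge of the path.\<close>
        with 3 have "(Some (g # normal_word u es ds), Some (normal_word (head G e) [] (ds @ [e]))) \<in> gis_cong G"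
          by (auto simp: z_def Nil normal_word_def intro: gis_cong.trans)
        moreover have "awalk v (ds @ [e]) (head G e)"
          using w True e Nil by (auto intro!: awalk_appendI simp: awalk_Cons_iff awalk_Nil_iff)
        ultimately show ?thesis using e by (auto intro!: has_normal_formI simp: awalk_Nil_iff)
      next
        case (Cons f es')
        define z' :: "('a, 'b) gis_gen list" where "z' = map Edge es' @ map Ghost (rev ds)"
        have z': "z = Edge f # z'" "set z' \<subseteq> gis_gens G" "f \<in> arcs G"
          using zg by (simp_all add: z_def z'_def Cons)
        \<comment> \<open>Now \<open>e\<^sup>*\<close> meets the first edge \<open>f\<close> and
          either cancels to a vertex or gives zero.\<close>
        have "(Some (Ghost e # z), if e = f then Some (Vertex (head G e) # z') else None) \<in> gis_cong G"
          using gis_cong_right[OF gis_cong.ghost_edge[OF e z'(3)] z'(2)] z'(1) by (auto split: if_splits)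
        with 3 have 4: "(Some (g # normal_word u es ds),
            if e = f then Some (normal_word (head G e) es' ds) else None) \<in> gis_cong G"
          by (auto simp: normal_word_def z'_def intro: gis_cong.trans)
        show ?thesis
        proof (cases "e = f")
          case True
          then show ?thesis using 4 w Cons by (auto intro!: has_normal_formI simp: awalk_Cons_iff)
        next
          case False
          then show ?thesis using 4 by (auto intro: has_normal_form_zeroI)
        qed
      qed
    next
      case False
      then show ?thesis using 1 2
        by (auto simp: nw Ghost intro!: has_normal_form_zeroI intro: gis_cong.trans gis_cong.sym)
    qed
  qed
qed

text \<open>Words grow by one generator on the left, which \<open>has_normal_form_Cons\<close>
  handles, and zero absorbs. The base cases are \<open>v = v v\<^sup>*\<close>,
  \<open>e = e r\<^sup>*\<close> and \<open>e\<^sup>* = r e\<^sup>*\<close>, with \<open>r\<close>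
  the range of \<open>e\<close>.\<close>

lemma has_normal_form:
  assumes "w \<noteq> []" "set w \<subseteq> gis_gens G"
  shows "has_normal_form w"
  using assms
proof (induction w rule: list_nonempty_induct)
  case (single g)
  show ?case
  proof (cases g)
    case (Vertex v)
    then have v: "v \<in> verts G" using single by simp
    then have "Some [Vertex v] \<in> gis_free G" by simp
    then have "(Some [g], Some (normal_word v [] [])) \<in> gis_cong G"
      by (simp add: Vertex normal_word_def gis_cong.refl)
    then show ?thesis using v by (auto intro!: has_normal_formI simp: awalk_Nil_iff)
  next
    case (Edge e)
    then have "e \<in> arcs G" using single by simp
    then show ?thesis unfolding Edge
      by (intro has_normal_formI[of _ "tail G e" "[e]" "[]" "head G e" "head G e"])
        (auto simp: normal_word_def awalk_Nil_iff awalk_Cons_iff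
          intro: gis_cong.sym[OF gis_cong.source_edge])
  next
    case (Ghost e)
    then have "e \<in> arcs G" using single by simp
    then show ?thesis unfolding Ghost
      by (intro has_normal_formI[of _ "head G e" "[]" "[e]" "head G e" "tail G e"])
        (auto simp: normal_word_def awalk_Nil_iff awalk_Cons_iff
          intro: gis_cong.sym[OF gis_cong.range_ghost])
  qed
next
  case (cons g w)
  then have g: "set [g] \<subseteq> gis_gens G" and "has_normal_form w" by auto
  from this(2) consider "(Some w, None) \<in> gis_cong G"
    | u es v ds r where "awalk u es r" "awalk v ds r" "(Some w, Some (normal_word u es ds)) \<in> gis_cong G"
    unfolding has_normal_form_def by blast
  then show ?case
  proof cases
    case 1
    from gis_cong_left[OF this g] show ?thesis by (auto intro: has_normal_form_zeroI)
  next
    case 2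
    from gis_cong_left[OF this(3) g] have "(Some (g # w), Some (g # normal_word u es ds)) \<in> gis_cong G"
      by simp
    then show ?thesis using has_normal_form_Cons 2 g by (auto intro: has_normal_form_trans)
  qed
qed

section \<open>Faithfulness of the action and uniqueness of normal forms\<close>

text \<open>The leading vertex takes care of length 0, where the edge part alone would be the
  identity on all pairs.\<close>

lemma list_act_edges:
  assumes "awalk u es r"
  shows "(gen_act G (Vertex u) \<circ>\<^sub>m list_act G (map Edge es)) = prefix_swap (u, es) (r, [])"
  using assms
proof (induction es arbitrary: u)
  case Nil
  then show ?case
    by (auto simp: awalk_Nil_iff prefix_swap_def fun_eq_iff)
next
  case (Cons e es)
  then have e: "e \<in> arcs G" "u = tail G e" and IH: "gen_act G (Vertex (head G e)) \<circ>\<^sub>m list_act G (map Edge es)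
      = prefix_swap (head G e, es) (r, [])" by (auto simp: awalk_Cons_iff)
  \<comment> \<open>Both sides equal the map of \<open>e\<close>. The exchange puts a vertex next to
    the remaining edges, where the induction hypothesis applies.\<close>
  have "gen_act G (Vertex u) \<circ>\<^sub>m gen_act G (Edge e) = gen_act G (Edge e) \<circ>\<^sub>m gen_act G (Vertex (head G e))"
    using e by (auto simp: map_comp_def fun_eq_iff)
  then have "gen_act G (Vertex u) \<circ>\<^sub>m list_act G (map Edge (e # es)) = gen_act G (Edge e) \<circ>\<^sub>m prefix_swap (head G e, es) (r, [])"
    unfolding IH[symmetric] by (simp add: map_comp_assoc[symmetric])
  also have "\<dots> = prefix_swap (u, e # es) (r, [])"
    using e by (auto simp: map_comp_def fun_eq_iff prefix_swap_def)
  finally show ?case .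
qed

text \<open>The first edge of \<open>ds\<close> is the last letter of the word, so it acts first and
  splits off on the right.\<close>

lemma list_act_ghosts:
  assumes "awalk v ds r"
  shows "(gen_act G (Vertex r) \<circ>\<^sub>m list_act G (map Ghost (rev ds))) = prefix_swap (r, []) (v, ds)"
  using assms
proof (induction ds arbitrary: v)
  case Nil
  then show ?case
    by (auto simp: awalk_Nil_iff prefix_swap_def fun_eq_iff)
next
  case (Cons e ds)
  then have e: "e \<in> arcs G" "v = tail G e" and IH: "gen_act G (Vertex r) \<circ>\<^sub>m list_act G (map Ghost (rev ds))
      = prefix_swap (r, []) (head G e, ds)" by (auto simp: awalk_Cons_iff)
  have "gen_act G (Vertex r) \<circ>\<^sub>m list_act G (map Ghost (rev (e # ds))) = prefix_swap (r, []) (head G e, ds) \<circ>\<^sub>m gen_act G (Ghost e)"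
    unfolding IH[symmetric] by (simp add: map_comp_assoc list_act_append)
  also have "\<dots> = prefix_swap (r, []) (v, e # ds)"
  proof
    fix z
    show "(prefix_swap (r, []) (head G e, ds) \<circ>\<^sub>m gen_act G (Ghost e)) z = prefix_swap (r, []) (v, e # ds) z"
      using e by (cases "(G, Ghost e :: ('a, 'b) gis_gen, z)" rule: gen_act.cases)
        (auto simp: map_comp_def prefix_swap_def)
  qed
  finally show ?case .
qed

lemma list_act_normal_word:
  assumes "awalk u es r" "awalk v ds r"
  shows "list_act G (normal_word u es ds) = prefix_swap (u, es) (v, ds)"
proof -
  \<comment> \<open>This map is defined only at base vertex \<open>r\<close>, so
    \<open>Vertex r\<close> can be inserted between edges and ghosts, as
    \<open>list_act_ghosts\<close> requires.\<close>
  have *: "prefix_swap (u, es) (r, []) \<circ>\<^sub>m gen_act G (Vertex r) = prefix_swap (u, es) (r, [])"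
    by (auto simp: map_comp_def prefix_swap_def)
  have "list_act G (normal_word u es ds) = prefix_swap (u, es) (r, []) \<circ>\<^sub>m list_act G (map Ghost (rev ds))"
    using list_act_edges[OF assms(1)]
    by (simp add: normal_word_def list_act_append map_comp_assoc[symmetric])
  also have "\<dots> = prefix_swap (u, es) (r, []) \<circ>\<^sub>m prefix_swap (r, []) (v, ds)"
    unfolding list_act_ghosts[OF assms(2), symmetric] map_comp_assoc[symmetric] * ..
  also have "\<dots> = prefix_swap (u, es) (v, ds)"
    using prefix_swap_comp_left[of "(u, es)" "(r, [])" "(r, [])"] by (simp add: path_concat_def)
  finally show ?thesis .
qed

lemma list_act_map_Edge:
  assumes "awalk u es r" "es \<noteq> []"
  shows "list_act G (map Edge es) = prefix_swap (u, es) (r, [])"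
proof -
  obtain e es' where es: "es = e # es'" using assms(2) by (cases es) auto
  then have "e \<in> arcs G" "u = tail G e" using assms(1) by (auto simp: awalk_Cons_iff)
  then have "gen_act G (Vertex u) \<circ>\<^sub>m gen_act G (Edge e) = gen_act G (Edge e)"
    using gis_cong_word_act[OF gis_cong.source_edge[of e]] by simp
  then have "list_act G (map Edge es) = gen_act G (Vertex u) \<circ>\<^sub>m list_act G (map Edge es)"
    by (simp add: es map_comp_assoc[symmetric])
  then show ?thesis using list_act_edges[OF assms(1)] by simp
qed

lemma list_act_map_Ghost:
  assumes "awalk v ds r" "ds \<noteq> []"
  shows "list_act G (map Ghost (rev ds)) = prefix_swap (r, []) (v, ds)"
proof -
  obtain e ds' where ds: "ds = ds' @ [e]" using assms(2) by (cases ds rule: rev_cases) auto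
  then have "e \<in> arcs G" "r = head G e" using assms(1) by (auto simp: awalk_Cons_iff awalk_Nil_iff)
  then have "gen_act G (Vertex r) \<circ>\<^sub>m gen_act G (Ghost e) = gen_act G (Ghost e)"
    using gis_cong_word_act[OF gis_cong.range_ghost[of e]] by simp
  then have "list_act G (map Ghost (rev ds)) = gen_act G (Vertex r) \<circ>\<^sub>m list_act G (map Ghost (rev ds))"
    by (simp add: ds map_comp_assoc[symmetric])
  then show ?thesis using list_act_ghosts[OF assms(1)] by simp
qed

lemma list_act_Vertex: "list_act G [Vertex v] = prefix_swap (v, []) (v, [])"
  by (auto simp: prefix_swap_def)

lemma gis_class_eqI: "(a, b) \<in> gis_cong G \<Longrightarrow> gis_class G a = gis_class G b"
  unfolding gis_class_def by (rule equiv_class_eq[OF equiv_gis_cong[OF wf_digraph_axioms]])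

text \<open>Each class is paired with the map by which it acts, so that the action can later decide
  which case holds.\<close>

lemma gis_class_cases:
  assumes "a \<in> gis_free G"
  obtains (zero) "gis_class G a = gis_zero G" "word_act G a = Map.empty"
  | (nf) p q where "p \<in> Path G" "q \<in> Path G" "path_range G p = path_range G q"
      "gis_class G a = gis_nf G p q" "word_act G a = prefix_swap p q"
proof -
  have "(a, None) \<in> gis_cong G \<or> (\<exists>u es v ds r. awalk u es r \<and> awalk v ds r \<and>
          (a, Some (normal_word u es ds)) \<in> gis_cong G)"
  proof (cases a)
    case None
    then show ?thesis using assms by (auto intro: gis_cong.refl)
  next
    case (Some w)
    then show ?thesis using has_normal_form[of w] assms
      by (auto simp: gis_free_def has_normal_form_def)
  qed
  then show thesis
  proof (elim disjE exE conjE)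
    assume "(a, None) \<in> gis_cong G"
    then show thesis using zero gis_class_eqI gis_cong_word_act
      by (metis gis_zero_def word_act.simps(1))
  next
    fix u es v ds r
    assume *: "awalk u es r" "awalk v ds r" "(a, Some (normal_word u es ds)) \<in> gis_cong G"
    show thesis
    proof (rule nf)
      show "(u, es) \<in> Path G" "(v, ds) \<in> Path G" "path_range G (u, es) = path_range G (v, ds)"
        using * by (simp_all add: PathI path_range_eq)
      show "gis_class G a = gis_nf G (u, es) (v, ds)"
        using gis_class_eqI[OF *(3)] by (simp add: gis_nf_def)
      show "word_act G a = prefix_swap (u, es) (v, ds)"
        using gis_cong_word_act[OF *(3)] list_act_normal_word[OF *(1,2)] by simp
    qed
  qed
qed

text \<open>The action excludes zero, since \<open>prefix_swap p q\<close> is not empty, and it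
  determines both paths by \<open>prefix_swap_inject\<close>. Elements can thus be identified by
  computing actions.\<close>

lemma gis_class_eq_nf:
  assumes "a \<in> gis_free G" "word_act G a = prefix_swap p q"
  shows "gis_class G a = gis_nf G p q"
  using assms(1)
proof (cases rule: gis_class_cases)
  case zero
  then show ?thesis using assms(2) prefix_swap_nonempty by metis
next
  case (nf p' q')
  then show ?thesis using assms(2) prefix_swap_inject by metis
qed

lemma gis_class_eq_zero:
  assumes "a \<in> gis_free G" "word_act G a = Map.empty"
  shows "gis_class G a = gis_zero G"
  using assms(1)
proof (cases rule: gis_class_cases)
  case (nf p' q')
  then show ?thesis using assms(2) prefix_swap_nonempty by metis
qed

lemma gis_cases:
  assumes "x \<in> gis G"
  obtains (zero) "x = gis_zero G"
  | (nf) p q where "p \<in> Path G" "q \<in> Path G" "path_range G p = path_range G q" "x = gis_nf G p q"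
proof -
  obtain a where a: "a \<in> gis_free G" "x = gis_class G a"
    using assms by (auto simp: gis_def gis_class_def elim: quotientE)
  from a(1) show thesis by (cases rule: gis_class_cases) (use a(2) zero nf in auto)
qed

lemma gis_class_mem: "a \<in> gis_free G \<Longrightarrow> gis_class G a \<in> gis G"
  by (simp add: gis_def gis_class_def quotientI)

lemma nf_word:
  assumes "p \<in> Path G" "q \<in> Path G" "path_range G p = path_range G q"
  shows "Some (normal_word (fst p) (snd p) (snd q)) \<in> gis_free G"
    and "word_act G (Some (normal_word (fst p) (snd p) (snd q))) = prefix_swap p q"
proof -
  have w: "awalk (fst p) (snd p) (path_range G p)" "awalk (fst q) (snd q) (path_range G p)"
    using assms by (auto simp: mem_Path_iff)
  show "word_act G (Some (normal_word (fst p) (snd p) (snd q))) = prefix_swap p q"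
    using list_act_normal_word[OF w] by simp
  show "Some (normal_word (fst p) (snd p) (snd q)) \<in> gis_free G"
    using normal_word_gens[OF w] by (simp add: normal_word_def)
qed

lemma gis_nf_mem:
  assumes "p \<in> Path G" "q \<in> Path G" "path_range G p = path_range G q"
  shows "gis_nf G p q \<in> gis G"
  using nf_word(1)[OF assms] by (simp add: gis_nf_def gis_class_mem)

text \<open>Equal classes have congruent words, which act by the same map;
  \<open>prefix_swap_inject\<close> recovers the paths.\<close>

lemma gis_nf_inject:
  assumes "p \<in> Path G" "q \<in> Path G" "path_range G p = path_range G q"
    and "p' \<in> Path G" "q' \<in> Path G" "path_range G p' = path_range G q'"
    and "gis_nf G p q = gis_nf G p' q'"
  shows "p = p' \<and> q = q'"
proof -
  let ?w = "Some (normal_word (fst p) (snd p) (snd q))"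
  let ?w' = "Some (normal_word (fst p') (snd p') (snd q'))"
  have "(?w, ?w') \<in> gis_cong G"
    using assms(7) nf_word(1)[OF assms(1-3)] nf_word(1)[OF assms(4-6)]
      eq_equiv_class_iff[OF equiv_gis_cong[OF wf_digraph_axioms]]
    by (simp add: gis_nf_def gis_class_def)
  then show ?thesis
    using gis_cong_word_act nf_word(2)[OF assms(1-3)] nf_word(2)[OF assms(4-6)] prefix_swap_inject
    by metis
qed

section \<open>Products of normal forms\<close>

text \<open>The concatenated word acts by the composite map, and the action identifies its class, so
  products need no further rewriting.\<close>

lemma gis_nf_mult:
  assumes "p \<in> Path G" "q \<in> Path G" "path_range G p = path_range G q"
    and "p' \<in> Path G" "q' \<in> Path G" "path_range G p' = path_range G q'"
  shows "prefix_swap p q \<circ>\<^sub>m prefix_swap p' q' = prefix_swap s t \<Longrightarrow>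
      gis_mult G (gis_nf G p q) (gis_nf G p' q') = gis_nf G s t"
    and "prefix_swap p q \<circ>\<^sub>m prefix_swap p' q' = Map.empty \<Longrightarrow>
      gis_mult G (gis_nf G p q) (gis_nf G p' q') = gis_zero G"
proof -
  let ?w = "Some (normal_word (fst p) (snd p) (snd q))"
  let ?w' = "Some (normal_word (fst p') (snd p') (snd q'))"
  note w = nf_word[OF assms(1-3)] and w' = nf_word[OF assms(4-6)]
  have free: "word_mult ?w ?w' \<in> gis_free G" using w(1) w'(1) by (rule word_mult_free)
  have mult: "gis_mult G (gis_nf G p q) (gis_nf G p' q') = gis_class G (word_mult ?w ?w')"
    using gis_mult_class[OF wf_digraph_axioms w(1) w'(1)] by (simp add: gis_nf_def)
  have act: "word_act G (word_mult ?w ?w') = prefix_swap p q \<circ>\<^sub>m prefix_swap p' q'"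
    using w(2) w'(2) by (simp only: word_act_mult)
  show "gis_mult G (gis_nf G p q) (gis_nf G p' q') = gis_nf G s t"
    if "prefix_swap p q \<circ>\<^sub>m prefix_swap p' q' = prefix_swap s t"
    unfolding mult using free act that by (intro gis_class_eq_nf) simp_all
  show "gis_mult G (gis_nf G p q) (gis_nf G p' q') = gis_zero G"
    if "prefix_swap p q \<circ>\<^sub>m prefix_swap p' q' = Map.empty"
    unfolding mult using free act that by (intro gis_class_eq_zero) simp_all
qed

lemma gis_nf_mult_left:
  assumes "p \<in> Path G" "q \<in> Path G" "t \<in> Path G" "s \<in> Path G"
    and "path_range G p = fst t" "path_range G q = fst t" "path_range G s = path_range G t"
  shows "gis_mult G (gis_nf G p q) (gis_nf G (path_concat q t) s) = gis_nf G (path_concat p t) s"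
  using assms by (intro gis_nf_mult(1) prefix_swap_comp_left) (simp_all add: path_concat_Path)

lemma gis_nf_mult_right:
  assumes "p \<in> Path G" "q \<in> Path G" "t \<in> Path G" "s \<in> Path G"
    and "path_range G s = fst t" "path_range G q = fst t" "path_range G p = path_range G t"
  shows "gis_mult G (gis_nf G p (path_concat q t)) (gis_nf G q s) = gis_nf G p (path_concat s t)"
  using assms by (intro gis_nf_mult(1) prefix_swap_comp_right) (simp_all add: path_concat_Path)

text \<open>Lifts a prefix relation from edge lists to paths: the remainder, based at the range of
  \<open>p\<close>, is itself a path.\<close>

lemma path_prefix:
  assumes "p \<in> Path G" "fst q = fst p" "snd q = snd p @ t" "q \<in> Path G"
  obtains r where "r \<in> Path G" "path_range G p = fst r" "q = path_concat p r"
    "snd r = t" "path_range G r = path_range G q"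
proof -
  have "awalk (fst p) (snd p @ t) (path_range G q)"
    using assms PathD[OF assms(4)] by simp
  then have "(path_range G p, t) \<in> Path G" by (auto simp: path_range_def intro: PathI)
  then obtain r where r: "r \<in> Path G" "fst r = path_range G p" "snd r = t" by fastforce
  then have "q = path_concat p r" using assms by (simp add: path_concat_def prod_eq_iff)
  then show thesis using r that path_concat_Path[OF assms(1) r(1)] by simp
qed

text \<open>A nonzero product acts by a nonempty map, so \<open>q\<close> and \<open>p'\<close> are
  comparable. The two cases are the shapes that \<open>gis_nf_mult_left\<close> and
  \<open>gis_nf_mult_right\<close> evaluate.\<close>

lemma gis_nf_mult_nonzero:
  assumes "p \<in> Path G" "q \<in> Path G" "path_range G p = path_range G q"
    and "p' \<in> Path G" "q' \<in> Path G" "path_range G p' = path_range G q'"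
    and "gis_mult G (gis_nf G p q) (gis_nf G p' q') \<noteq> gis_zero G"
  obtains t where "t \<in> Path G" "path_range G q = fst t" "p' = path_concat q t"
      "path_range G t = path_range G p'"
  | t where "t \<in> Path G" "path_range G p' = fst t" "q = path_concat p' t"
      "path_range G t = path_range G q"
proof -
  have "prefix_swap p q \<circ>\<^sub>m prefix_swap p' q' \<noteq> Map.empty"
    using gis_nf_mult(2)[OF assms(1-6)] assms(7) by blast
  then obtain t where t: "fst q = fst p'" "snd p' = snd q @ t \<or> snd q = snd p' @ t"
    using prefix_swap_comp_nonempty by blast
  from t(2) show thesis
  proof
    assume "snd p' = snd q @ t"
    from path_prefix[OF assms(2) t(1)[symmetric] this assms(4)] that(1) show thesis by metis
  next
    assume "snd q = snd p' @ t"
    from path_prefix[OF assms(4) t(1) this assms(2)] that(2) show thesis by metis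
  qed
qed

text \<open>One of \<open>a\<close> and \<open>d\<close> is a prefix of the other; \<open>u\<close>
  is the excess of the longer one, and the same piece opens the longer of the two final
  factors.\<close>

lemma path_concat_eq_cases:
  assumes "a \<in> Path G" "t \<in> Path G" "path_range G a = fst t"
    and "d \<in> Path G" "k \<in> Path G" "path_range G d = fst k"
    and "path_concat a t = path_concat d k"
  obtains u where "u \<in> Path G" "path_range G d = fst u" "a = path_concat d u"
      "k = path_concat u t" "path_range G u = path_range G a"
  | u where "u \<in> Path G" "path_range G a = fst u" "d = path_concat a u"
      "t = path_concat u k" "path_range G u = path_range G d"
proof -
  have f: "fst a = fst d" and "snd a @ snd t = snd d @ snd k"
    using assms(7) by (auto simp: path_concat_def)
  then have "\<exists>y. snd a = snd d @ y \<and> y @ snd t = snd k \<or> snd a @ y = snd d \<and> snd t = y @ snd k"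
    unfolding append_eq_append_conv2 by blast
  then show thesis
  proof (elim exE disjE conjE)
    fix y assume y: "snd a = snd d @ y" "y @ snd t = snd k"
    from assms(4) f y(1) assms(1) obtain u where u: "u \<in> Path G" "path_range G d = fst u"
      "a = path_concat d u" "snd u = y" "path_range G u = path_range G a"
      by (rule path_prefix)
    moreover from this have "k = path_concat u t"
      using y(2) assms(6) by (simp add: path_concat_def prod_eq_iff)
    ultimately show thesis using that(1) by blast
  next
    fix y assume y: "snd a @ y = snd d" "snd t = y @ snd k"
    from assms(1) f[symmetric] y(1)[symmetric] assms(4) obtain u where u: "u \<in> Path G" "path_range G a = fst u"
      "d = path_concat a u" "snd u = y" "path_range G u = path_range G d"
      by (rule path_prefix)
    moreover from this have "t = path_concat u k"
      using y(2) assms(3) by (simp add: path_concat_def prod_eq_iff)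
    ultimately show thesis using that(2) by blast
  qed
qed

lemma path_concat_vertex [simp]:
  "fst p = v \<Longrightarrow> path_concat (v, []) p = p" "path_concat p (w, []) = p"
  by (auto simp: path_concat_def prod_eq_iff)

lemma fst_path_concat [simp]: "fst (path_concat p q) = fst p"
  by (simp add: path_concat_def)

lemma path_concat_assoc: "path_concat (path_concat p q) r = path_concat p (path_concat q r)"
  by (simp add: path_concat_def)

section \<open>Paths, stars and conjugates in normal form\<close>

text \<open>A path is \<open>p v\<^sup>*\<close> with \<open>v\<close> its range. Length 0 is
  separate because the word is then a vertex; in both cases the actions are compared.\<close>

lemma gis_path_eq_nf:
  assumes "p \<in> Path G"
  shows "gis_path G p = gis_nf G p (path_range G p, [])"
proof (cases "snd p = []")
  case True
  then have "path_range G p = fst p" "fst p \<in> verts G"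
    using PathD[OF assms] by (auto simp: awalk_Nil_iff)
  moreover from True have "p = (fst p, [])" by (simp add: prod_eq_iff)
  ultimately show ?thesis using True list_act_Vertex[of "fst p"]
    unfolding gis_path_def by (intro gis_class_eq_nf) auto
next
  case False
  have "set (snd p) \<subseteq> arcs G" using PathD[OF assms] by blast
  then show ?thesis using False list_act_map_Edge[OF PathD[OF assms] False]
    unfolding gis_path_def by (intro gis_class_eq_nf) auto
qed

lemma gis_star_eq_nf:
  assumes "p \<in> Path G"
  shows "gis_star G p = gis_nf G (path_range G p, []) p"
proof (cases "snd p = []")
  case True
  then have "path_range G p = fst p" "fst p \<in> verts G"
    using PathD[OF assms] by (auto simp: awalk_Nil_iff)
  moreover from True have "p = (fst p, [])" by (simp add: prod_eq_iff)
  ultimately show ?thesis using True list_act_Vertex[of "fst p"]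
    unfolding gis_star_def by (intro gis_class_eq_nf) auto
next
  case False
  have "set (snd p) \<subseteq> arcs G" using PathD[OF assms] by blast
  then show ?thesis using False list_act_map_Ghost[OF PathD[OF assms] False]
    unfolding gis_star_def by (intro gis_class_eq_nf) auto
qed

lemma gis_path_mem: "p \<in> Path G \<Longrightarrow> gis_path G p \<in> gis G"
  by (simp add: gis_path_eq_nf gis_nf_mem vertex_Path path_range_verts)

lemma gis_star_mem: "p \<in> Path G \<Longrightarrow> gis_star G p \<in> gis G"
  by (simp add: gis_star_eq_nf gis_nf_mem vertex_Path path_range_verts)

lemma gis_path_star:
  assumes "p \<in> Path G" "q \<in> Path G" "path_range G p = path_range G q"
  shows "gis_mult G (gis_path G p) (gis_star G q) = gis_nf G p q"
  using gis_nf_mult_left[of p "(path_range G q, [])" "(path_range G q, [])" q] assms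
  by (simp add: gis_path_eq_nf gis_star_eq_nf vertex_Path path_range_verts)

lemma gis_path_path:
  assumes "p \<in> Path G" "q \<in> Path G" "path_range G p = fst q"
  shows "gis_mult G (gis_path G p) (gis_path G q) = gis_path G (path_concat p q)"
  using gis_nf_mult_left[of p "(fst q, [])" q "(path_range G q, [])"] assms
    path_range_verts[OF assms(1)] path_range_verts[OF assms(2)]
  by (simp add: gis_path_eq_nf vertex_Path path_concat_Path)

lemma gis_star_star:
  assumes "p \<in> Path G" "q \<in> Path G" "path_range G p = fst q"
  shows "gis_mult G (gis_star G q) (gis_star G p) = gis_star G (path_concat p q)"
  using gis_nf_mult_right[of "(path_range G q, [])" "(fst q, [])" q p] assms
    path_range_verts[OF assms(1)] path_range_verts[OF assms(2)]
  by (simp add: gis_star_eq_nf vertex_Path path_concat_Path)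

lemma gis_mult_zero:
  assumes "x \<in> gis G"
  shows "gis_mult G (gis_zero G) x = gis_zero G" "gis_mult G x (gis_zero G) = gis_zero G"
proof -
  obtain a where a: "a \<in> gis_free G" "x = gis_class G a"
    using assms by (auto simp: gis_def gis_class_def elim: quotientE)
  have z: "None \<in> gis_free G" by (simp add: gis_free_def)
  show "gis_mult G (gis_zero G) x = gis_zero G" "gis_mult G x (gis_zero G) = gis_zero G"
    using gis_mult_class[OF wf_digraph_axioms z a(1)] gis_mult_class[OF wf_digraph_axioms a(1) z] a
    by (simp_all add: gis_zero_def)
qed

lemma ClPath_iff: "c \<in> ClPath G \<longleftrightarrow> c \<in> Path G \<and> path_range G c = fst c"
  by (auto simp: ClPath_def path_source_def)

lemma gis_conj_path:
  assumes "p \<in> Path G" "c \<in> ClPath G" "path_range G p = fst c"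
  shows "gis_mult G (gis_mult G (gis_path G p) (gis_path G c)) (gis_star G p) = gis_nf G (path_concat p c) p"
  using assms by (simp add: ClPath_iff gis_path_path gis_path_star path_concat_Path)

lemma gis_conj_star:
  assumes "p \<in> Path G" "c \<in> ClPath G" "path_range G p = fst c"
  shows "gis_mult G (gis_mult G (gis_path G p) (gis_star G c)) (gis_star G p) = gis_nf G p (path_concat p c)"
  using assms gis_nf_mult_right[of p "(fst c, [])" c p] path_range_verts[OF assms(1)]
  by (simp add: ClPath_iff gis_path_star gis_star_eq_nf[of p] vertex_Path)

text \<open>Condition (1) does not link the range of \<open>p\<close> with the source of the closed
  path, so mismatched products must be excluded. The base vertices differ, so the composite map is
  empty.\<close>

lemma gis_conj_zero:
  assumes "p \<in> Path G" "c \<in> ClPath G" "path_range G p \<noteq> fst c"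
  shows "gis_mult G (gis_mult G (gis_path G p) (gis_path G c)) (gis_star G p) = gis_zero G"
    and "gis_mult G (gis_mult G (gis_path G p) (gis_star G c)) (gis_star G p) = gis_zero G"
proof -
  let ?v = "(path_range G p, []) :: ('a, 'b) path" and ?w = "(fst c, []) :: ('a, 'b) path"
  have v: "?v \<in> Path G" "?w \<in> Path G" "path_range G ?v = path_range G p" "path_range G ?w = fst c"
    and c: "c \<in> Path G" "path_range G c = fst c"
    using assms path_range_verts[OF assms(1)] path_range_verts[of c] vertex_Path
    by (auto simp: ClPath_iff)
  have "gis_mult G (gis_nf G p ?v) (gis_nf G c ?w) = gis_zero G"
    "gis_mult G (gis_nf G p ?v) (gis_nf G ?w c) = gis_zero G"
    using assms v c
    by (intro gis_nf_mult(2); force simp: fun_eq_iff map_comp_def prefix_swap_def split: option.splits)+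
  then show "gis_mult G (gis_mult G (gis_path G p) (gis_path G c)) (gis_star G p) = gis_zero G"
    "gis_mult G (gis_mult G (gis_path G p) (gis_star G c)) (gis_star G p) = gis_zero G"
    using assms c gis_mult_zero(1)[OF gis_star_mem[OF assms(1)]]
    by (simp_all add: gis_path_eq_nf gis_star_eq_nf)
qed

section \<open>The three conditions imply centrality\<close>

text \<open>The assumptions are the three conditions in terms of normal forms. Comparing
  \<open>b\<close> with \<open>c\<close>, and then the two paths of \<open>g h\<close>, leaves cases
  in which both products are explicit conjugates.\<close>

lemma delta_mult_swap:
  fixes \<delta> :: "('a, 'b) gis_elem \<Rightarrow> 'r::ring"
  assumes zero: "\<delta> (gis_zero G) = 0"
    and support: "\<And>p q. p \<in> Path G \<Longrightarrow> q \<in> Path G \<Longrightarrow> path_range G p = path_range G q \<Longrightarrow>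
      \<delta> (gis_nf G p q) \<noteq> 0 \<Longrightarrow>
      \<exists>c \<in> ClPath G. p = path_concat q c \<and> path_range G q = fst c \<or>
        q = path_concat p c \<and> path_range G p = fst c"
    and conj_path: "\<And>p c. p \<in> Path G \<Longrightarrow> c \<in> ClPath G \<Longrightarrow> path_range G p = fst c \<Longrightarrow>
      \<delta> (gis_nf G (path_concat p c) p) = \<delta> (gis_path G c)"
    and conj_star: "\<And>p c. p \<in> Path G \<Longrightarrow> c \<in> ClPath G \<Longrightarrow> path_range G p = fst c \<Longrightarrow>
      \<delta> (gis_nf G p (path_concat p c)) = \<delta> (gis_star G c)"
    and rot: "\<And>x y. x \<in> Path G \<Longrightarrow> y \<in> Path G \<Longrightarrow> path_range G x = fst y \<Longrightarrow> path_range G y = fst x \<Longrightarrow>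
      \<delta> (gis_path G (path_concat x y)) = \<delta> (gis_path G (path_concat y x)) \<and>
      \<delta> (gis_star G (path_concat x y)) = \<delta> (gis_star G (path_concat y x))"
    and g: "a \<in> Path G" "b \<in> Path G" "path_range G a = path_range G b"
    and h: "c \<in> Path G" "d \<in> Path G" "path_range G c = path_range G d"
    and nz: "\<delta> (gis_mult G (gis_nf G a b) (gis_nf G c d)) \<noteq> 0"
  shows "\<delta> (gis_mult G (gis_nf G a b) (gis_nf G c d)) = \<delta> (gis_mult G (gis_nf G c d) (gis_nf G a b))"
proof -
  let ?gh = "gis_mult G (gis_nf G a b) (gis_nf G c d)"
  let ?hg = "gis_mult G (gis_nf G c d) (gis_nf G a b)"
  note [simp] = path_concat_Path path_concat_assoc
  have "?gh \<noteq> gis_zero G" using nz zero by auto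
  from g h this show ?thesis
  proof (cases rule: gis_nf_mult_nonzero)
    \<comment> \<open>Here \<open>c = b t\<close> and \<open>g h = a t d\<^sup>*\<close>; condition
      (1) makes \<open>a t\<close> and \<open>d\<close> differ by a closed path
      \<open>k\<close>.\<close>
    case (1 t)
    have gh: "?gh = gis_nf G (path_concat a t) d"
      unfolding 1(3) using 1(1,2,4) g h by (intro gis_nf_mult_left) auto
    have at: "path_concat a t \<in> Path G" "path_range G (path_concat a t) = path_range G d"
      using 1 g h by auto
    obtain k where "k \<in> ClPath G" and "path_concat a t = path_concat d k \<and> path_range G d = fst k \<or>
        d = path_concat (path_concat a t) k \<and> path_range G (path_concat a t) = fst k"
      using support[OF at(1) h(2) at(2)] nz gh by auto
    note k = \<open>k \<in> ClPath G\<close> \<open>k \<in> ClPath G\<close>[unfolded ClPath_iff]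
    from \<open>_ \<or> _\<close> show ?thesis
    proof (elim disjE conjE)
      assume eq: "path_concat a t = path_concat d k" and dk: "path_range G d = fst k"
      have gh': "\<delta> ?gh = \<delta> (gis_path G k)"
        unfolding gh eq using k h dk by (intro conj_path)
      have "path_range G a = fst t" using g 1(2) by simp
      from g(1) 1(1) this h(2) k(2)[THEN conjunct1] dk eq show ?thesis
      proof (cases rule: path_concat_eq_cases)
        \<comment> \<open>With \<open>a = d u\<close> and \<open>k = u t\<close>, the product
          \<open>h g\<close> is the conjugate by \<open>b\<close> of \<open>t u\<close>, a rotation
          of \<open>k\<close>.\<close>
        case u: (1 u)
        have "?hg = gis_nf G (path_concat c u) b"
          unfolding u(3) using u(1,2,5) g h by (intro gis_nf_mult_left) auto
        also have "path_concat c u = path_concat b (path_concat t u)" using 1(3) by simp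
        also have "\<delta> (gis_nf G (path_concat b (path_concat t u)) b) = \<delta> (gis_path G (path_concat t u))"
          using u(1,2,5) 1(1,2,4) g h by (intro conj_path) (auto simp: ClPath_iff)
        also have "\<dots> = \<delta> (gis_path G (path_concat u t))"
          using u(1,2,5) 1(1,2,4) g h by (intro rot[THEN conjunct1]) auto
        finally show ?thesis using gh' u(4) by simp
      next
        \<comment> \<open>With \<open>d = a u\<close> and \<open>t = u k\<close>, the product
          \<open>h g\<close> is the conjugate of \<open>k\<close> itself by
          \<open>b u\<close>.\<close>
        case u: (2 u)
        have "?hg = gis_nf G c (path_concat b u)"
          unfolding u(3) using u(1,2,5) g h by (intro gis_nf_mult_right) auto
        also have "\<dots> = gis_nf G (path_concat (path_concat b u) k) (path_concat b u)"
          using 1(3) u(4) by simp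
        also have "\<delta> \<dots> = \<delta> (gis_path G k)"
          using u(1,2,5) 1(1,2,4) g h k dk by (intro conj_path) auto
        finally show ?thesis using gh' by simp
      qed
    next
      \<comment> \<open>Now \<open>g h\<close> is a conjugate of \<open>k\<^sup>*\<close> by
        \<open>a t\<close>, and \<open>h g\<close> is one by \<open>c = b t\<close>.\<close>
      assume eq: "d = path_concat (path_concat a t) k" and tk: "path_range G (path_concat a t) = fst k"
      have gh': "\<delta> ?gh = \<delta> (gis_star G k)"
        unfolding gh unfolding eq using k at tk by (intro conj_star)
      have tk': "path_range G t = fst k" using tk path_concat_Path(2)[OF g(1) 1(1)] g(3) 1(2) by simp
      then have ck: "path_range G c = fst k" using 1(4) by simp
      have "?hg = gis_nf G c (path_concat b (path_concat t k))"
        unfolding eq path_concat_assoc using 1(1,2) g h(1) k(2) tk' ck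
        by (intro gis_nf_mult_right) simp_all
      also have "\<dots> = gis_nf G c (path_concat c k)" using 1(3) by simp
      also have "\<delta> \<dots> = \<delta> (gis_star G k)"
        using h(1) k ck by (intro conj_star) auto
      finally show ?thesis using gh' by simp
    qed
  next
    \<comment> \<open>The dual situation \<open>b = c t\<close>, where
      \<open>g h = a t\<^sup>* d\<^sup>*\<close>. The same comparisons apply with paths and stars
      exchanged.\<close>
    case (2 t)
    have gh: "?gh = gis_nf G a (path_concat d t)"
      unfolding 2(3) using 2(1,2,4) g h by (intro gis_nf_mult_right) auto
    have dt: "path_concat d t \<in> Path G" "path_range G a = path_range G (path_concat d t)"
      using 2 g h by auto
    obtain k where "k \<in> ClPath G" and "a = path_concat (path_concat d t) k \<and> path_range G (path_concat d t) = fst k \<or>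
        path_concat d t = path_concat a k \<and> path_range G a = fst k"
      using support[OF g(1) dt] nz gh by auto
    note k = \<open>k \<in> ClPath G\<close> \<open>k \<in> ClPath G\<close>[unfolded ClPath_iff]
    from \<open>_ \<or> _\<close> show ?thesis
    proof (elim disjE conjE)
      assume eq: "path_concat d t = path_concat a k" and ak: "path_range G a = fst k"
      have gh': "\<delta> ?gh = \<delta> (gis_star G k)"
        unfolding gh eq using k g ak by (intro conj_star)
      have "path_range G d = fst t" using h 2(2) by simp
      from h(2) 2(1) this g(1) k(2)[THEN conjunct1] ak eq show ?thesis
      proof (cases rule: path_concat_eq_cases)
        case u: (1 u)
        have "?hg = gis_nf G c (path_concat b u)"
          unfolding u(3) using u(1,2,5) g h by (intro gis_nf_mult_right) auto
        also have "path_concat b u = path_concat c (path_concat t u)" using 2(3) by simp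
        also have "\<delta> (gis_nf G c (path_concat c (path_concat t u))) = \<delta> (gis_star G (path_concat t u))"
          using u(1,2,5) 2(1,2,4) g h by (intro conj_star) (auto simp: ClPath_iff)
        also have "\<dots> = \<delta> (gis_star G (path_concat u t))"
          using u(1,2,5) 2(1,2,4) g h by (intro rot[THEN conjunct2]) auto
        finally show ?thesis using gh' u(4) by simp
      next
        case u: (2 u)
        have "?hg = gis_nf G (path_concat c u) b"
          unfolding u(3) using u(1,2,5) g h by (intro gis_nf_mult_left) auto
        also have "\<dots> = gis_nf G (path_concat c u) (path_concat (path_concat c u) k)"
          using 2(3) u(4) by simp
        also have "\<delta> \<dots> = \<delta> (gis_star G k)"
          using u(1,2,5) 2(1,2,4) g h k ak by (intro conj_star) auto
        finally show ?thesis using gh' by simp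
      qed
    next
      assume eq: "a = path_concat (path_concat d t) k" and tk: "path_range G (path_concat d t) = fst k"
      have gh': "\<delta> ?gh = \<delta> (gis_path G k)"
        unfolding gh unfolding eq using k dt tk by (intro conj_path)
      have tk': "path_range G t = fst k" using tk path_concat_Path(2)[OF h(2) 2(1)] h(3) 2(2) by simp
      then have ck: "path_range G b = fst k" using 2(4) by simp
      have "?hg = gis_nf G (path_concat c (path_concat t k)) b"
        unfolding eq path_concat_assoc using 2(1,2) h g(2) k(2) tk' ck
        by (intro gis_nf_mult_left) simp_all
      also have "\<dots> = gis_nf G (path_concat b k) b" using 2(3) by simp
      also have "\<delta> \<dots> = \<delta> (gis_path G k)"
        using g(2) k ck by (intro conj_path) auto
      finally show ?thesis using gh' by simp
    qed
  qed
qed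

lemma cl_equiv_iff:
  "cl_equiv G p q \<longleftrightarrow> (\<exists>x \<in> Path G. \<exists>y \<in> Path G. path_range G x = fst y \<and> path_range G y = fst x \<and>
     p = path_concat x y \<and> q = path_concat y x)"
  by (auto simp: cl_equiv_def path_source_def)

text \<open>The conditions are first restated for normal forms, as \<open>delta_mult_swap\<close>
  expects; products with zero are treated directly.\<close>

lemma central_map_of_conditions:
  fixes \<delta> :: "('a, 'b) gis_elem \<Rightarrow> 'r::ring"
  assumes zero: "\<delta> (gis_zero G) = 0"
    and support: "\<forall>x \<in> gis G. \<delta> x \<noteq> 0 \<longrightarrow>
       (\<exists>p \<in> Path G. \<exists>q \<in> ClPath G.
          x = gis_mult G (gis_mult G (gis_path G p) (gis_path G q)) (gis_star G p) \<or>
          x = gis_mult G (gis_mult G (gis_path G p) (gis_star G q)) (gis_star G p))"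
    and conj: "\<forall>p \<in> Path G. \<forall>q \<in> ClPath G. path_range G p = path_source q \<longrightarrow>
       \<delta> (gis_mult G (gis_mult G (gis_path G p) (gis_path G q)) (gis_star G p))
         = \<delta> (gis_path G q) \<and>
       \<delta> (gis_mult G (gis_mult G (gis_path G p) (gis_star G q)) (gis_star G p))
         = \<delta> (gis_star G q)"
    and rot: "\<forall>p \<in> ClPath G. \<forall>q \<in> ClPath G. cl_equiv G p q \<longrightarrow>
       \<delta> (gis_path G p) = \<delta> (gis_path G q) \<and> \<delta> (gis_star G p) = \<delta> (gis_star G q)"
  shows "central_map G \<delta>"
proof -
  have support': "\<exists>c \<in> ClPath G. p = path_concat q c \<and> path_range G q = fst c \<or>
      q = path_concat p c \<and> path_range G p = fst c"
    if pq: "p \<in> Path G" "q \<in> Path G" "path_range G p = path_range G q" and nz: "\<delta> (gis_nf G p q) \<noteq> 0" for p q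
  proof -
    obtain r c where rc: "r \<in> Path G" "c \<in> ClPath G" and
      eq: "gis_nf G p q = gis_mult G (gis_mult G (gis_path G r) (gis_path G c)) (gis_star G r) \<or>
       gis_nf G p q = gis_mult G (gis_mult G (gis_path G r) (gis_star G c)) (gis_star G r)"
      using support[rule_format, OF gis_nf_mem[OF pq] nz] by (elim bexE) (rule that)
    have *: "path_range G r = fst c"
    proof (rule ccontr)
      assume "path_range G r \<noteq> fst c"
      then show False using gis_conj_zero[OF rc] eq nz zero by auto
    qed
    have rc': "path_concat r c \<in> Path G" and range: "path_range G (path_concat r c) = path_range G r"
      using path_concat_Path[OF rc(1) _ *] rc(2) * by (simp_all add: ClPath_iff)
    from eq consider "gis_nf G p q = gis_nf G (path_concat r c) r" | "gis_nf G p q = gis_nf G r (path_concat r c)"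
      unfolding gis_conj_path[OF rc *] gis_conj_star[OF rc *] by blast
    \<comment> \<open>Uniqueness of normal forms turns an equation in \<open>G\<^sub>E\<close> into
      one between paths.\<close>
    then have "p = path_concat r c \<and> q = r \<or> p = r \<and> q = path_concat r c"
    proof cases
      case 1
      from gis_nf_inject[OF pq rc' rc(1) range 1] show ?thesis by blast
    next
      case 2
      from gis_nf_inject[OF pq rc(1) rc' range[symmetric] 2] show ?thesis by blast
    qed
    then show ?thesis using rc * by blast
  qed
  have conj': "\<delta> (gis_nf G (path_concat p c) p) = \<delta> (gis_path G c)"
    "\<delta> (gis_nf G p (path_concat p c)) = \<delta> (gis_star G c)"
    if "p \<in> Path G" "c \<in> ClPath G" "path_range G p = fst c" for p c
    using conj[rule_format, OF that(1,2)] that(3)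
    unfolding gis_conj_path[OF that] gis_conj_star[OF that] path_source_def by blast+
  have rot': "\<delta> (gis_path G (path_concat x y)) = \<delta> (gis_path G (path_concat y x)) \<and>
      \<delta> (gis_star G (path_concat x y)) = \<delta> (gis_star G (path_concat y x))"
    if "x \<in> Path G" "y \<in> Path G" "path_range G x = fst y" "path_range G y = fst x" for x y
  proof -
    have "cl_equiv G (path_concat x y) (path_concat y x)" using that by (auto simp: cl_equiv_iff)
    moreover have "path_concat x y \<in> ClPath G" "path_concat y x \<in> ClPath G"
      using that by (simp_all add: ClPath_iff path_concat_Path)
    ultimately show ?thesis using rot by blast
  qed
  have swap: "\<delta> (gis_mult G (gis_nf G a b) (gis_nf G c d)) = \<delta> (gis_mult G (gis_nf G c d) (gis_nf G a b))"
    if "a \<in> Path G" "b \<in> Path G" "path_range G a = path_range G b"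
      "c \<in> Path G" "d \<in> Path G" "path_range G c = path_range G d"
      "\<delta> (gis_mult G (gis_nf G a b) (gis_nf G c d)) \<noteq> 0" for a b c d
    by (rule delta_mult_swap[OF zero _ _ _ _ that]) (fact support' conj' rot')+
  show ?thesis unfolding central_map_def
  proof (intro ballI)
    fix g h assume g: "g \<in> gis G" and h: "h \<in> gis G"
    show "\<delta> (gis_mult G g h) = \<delta> (gis_mult G h g)"
    proof (cases "g = gis_zero G \<or> h = gis_zero G")
      case True
      then show ?thesis using gis_mult_zero g h by auto
    next
      case False
      obtain a b where ab: "a \<in> Path G" "b \<in> Path G" "path_range G a = path_range G b" "g = gis_nf G a b"
        using g by (cases rule: gis_cases) (use False in auto)
      obtain c d where cd: "c \<in> Path G" "d \<in> Path G" "path_range G c = path_range G d" "h = gis_nf G c d"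
        using h by (cases rule: gis_cases) (use False in auto)
      \<comment> \<open>If either value is nonzero, the swap in that direction gives equality;
        otherwise both values are 0.\<close>
      show ?thesis unfolding ab(4) cd(4)
        using swap[OF ab(1-3) cd(1-3)] swap[OF cd(1-3) ab(1-3)] by argo
    qed
  qed
qed

section \<open>Centrality implies the three conditions\<close>

text \<open>By centrality \<open>q\<^sup>* p\<close> also has a nonzero value under
  \<open>\<delta>\<close>, hence is not zero. So \<open>p\<close> and \<open>q\<close> are
  comparable, and their equal ranges make the difference a closed path.\<close>

lemma central_map_support:
  fixes \<delta> :: "('a, 'b) gis_elem \<Rightarrow> 'r::ring"
  assumes zero: "\<delta> (gis_zero G) = 0" and central: "central_map G \<delta>"
    and x: "x \<in> gis G" and nz: "\<delta> x \<noteq> 0"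
  shows "\<exists>p \<in> Path G. \<exists>q \<in> ClPath G.
    x = gis_mult G (gis_mult G (gis_path G p) (gis_path G q)) (gis_star G p) \<or>
    x = gis_mult G (gis_mult G (gis_path G p) (gis_star G q)) (gis_star G p)"
  using x
proof (cases rule: gis_cases)
  case zero
  then show ?thesis using nz \<open>\<delta> (gis_zero G) = 0\<close> by simp
next
  case (nf p q)
  \<comment> \<open>The common range as a path of length 0 supplies the trivial halves of
    \<open>q\<^sup>* = v q\<^sup>*\<close> and \<open>p = p v\<^sup>*\<close>.\<close>
  define v where "v = (path_range G q, [] :: 'b list)"
  have v: "v \<in> Path G" "path_range G v = path_range G q"
    using vertex_Path[OF path_range_verts[OF nf(2)]] by (simp_all add: v_def)
  have "x = gis_mult G (gis_path G p) (gis_star G q)" using nf gis_path_star by simp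
  then have "\<delta> (gis_mult G (gis_star G q) (gis_path G p)) \<noteq> 0"
    using central gis_path_mem[OF nf(1)] gis_star_mem[OF nf(2)] nz unfolding central_map_def by simp
  then have "gis_mult G (gis_nf G v q) (gis_nf G p v) \<noteq> gis_zero G"
    using zero gis_path_eq_nf[OF nf(1)] gis_star_eq_nf[OF nf(2)] nf(3) by (auto simp: v_def)
  from v(1) nf(2) v(2) nf(1) v(1) nf(3)[folded v(2)] this show ?thesis
  proof (cases rule: gis_nf_mult_nonzero)
    case (1 t)
    have t: "t \<in> ClPath G" using 1(1,2,4) nf(3) by (simp add: ClPath_iff)
    have "x = gis_nf G (path_concat q t) q" using nf(4) 1(3) by simp
    then show ?thesis using gis_conj_path[OF nf(2) t 1(2)] nf(2) t by metis
  next
    case (2 t)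
    have t: "t \<in> ClPath G" using 2(1,2,4) nf(3) by (simp add: ClPath_iff)
    have "x = gis_nf G p (path_concat p t)" using nf(4) 2(3) by simp
    then show ?thesis using gis_conj_star[OF nf(1) t 2(2)] nf(1) t by metis
  qed
qed

lemma gis_star_path:
  assumes "p \<in> Path G" "q \<in> Path G" "path_range G p = fst q"
  shows "gis_mult G (gis_star G p) (gis_path G (path_concat p q)) = gis_path G q"
    and "gis_mult G (gis_star G (path_concat p q)) (gis_path G p) = gis_star G q"
  using gis_nf_mult_left[of "(fst q, [])" p q "(path_range G q, [])"]
    gis_nf_mult_right[of "(path_range G q, [])" p q "(fst q, [])"] assms
    path_range_verts[OF assms(1)] path_range_verts[OF assms(2)]
  by (simp_all add: gis_path_eq_nf gis_star_eq_nf vertex_Path path_concat_Path)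

text \<open>The conjugates are regrouped, through their normal forms, as \<open>p q\<close> times
  \<open>p\<^sup>*\<close> and \<open>p\<close> times the star of \<open>p q\<close>. Swapping the
  factors cancels \<open>p\<^sup>* p\<close>.\<close>

lemma central_map_conj:
  fixes \<delta> :: "('a, 'b) gis_elem \<Rightarrow> 'r::ring"
  assumes central: "central_map G \<delta>"
    and p: "p \<in> Path G" and q: "q \<in> ClPath G" and pq: "path_range G p = fst q"
  shows "\<delta> (gis_mult G (gis_mult G (gis_path G p) (gis_path G q)) (gis_star G p)) = \<delta> (gis_path G q)"
    and "\<delta> (gis_mult G (gis_mult G (gis_path G p) (gis_star G q)) (gis_star G p)) = \<delta> (gis_star G q)"
proof -
  have q': "q \<in> Path G" "path_range G q = fst q" using q by (simp_all add: ClPath_iff)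
  note c = path_concat_Path[OF p q'(1) pq]
  have "gis_mult G (gis_mult G (gis_path G p) (gis_path G q)) (gis_star G p)
      = gis_mult G (gis_path G (path_concat p q)) (gis_star G p)"
    using gis_conj_path[OF p q pq] gis_path_star[OF c(1) p] c q' pq by simp
  then show "\<delta> (gis_mult G (gis_mult G (gis_path G p) (gis_path G q)) (gis_star G p)) = \<delta> (gis_path G q)"
    using central gis_path_mem[OF c(1)] gis_star_mem[OF p] gis_star_path(1)[OF p q'(1) pq]
    unfolding central_map_def by metis
  have "gis_mult G (gis_mult G (gis_path G p) (gis_star G q)) (gis_star G p)
      = gis_mult G (gis_path G p) (gis_star G (path_concat p q))"
    using gis_conj_star[OF p q pq] gis_path_star[OF p c(1)] c q' pq by simp
  then show "\<delta> (gis_mult G (gis_mult G (gis_path G p) (gis_star G q)) (gis_star G p)) = \<delta> (gis_star G q)"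
    using central gis_star_mem[OF c(1)] gis_path_mem[OF p] gis_star_path(2)[OF p q'(1) pq]
    unfolding central_map_def by metis
qed

text \<open>A concatenation is a product in \<open>G\<^sub>E\<close>, and the star reverses
  products; so rotating a closed path swaps two factors.\<close>

lemma central_map_rot:
  fixes \<delta> :: "('a, 'b) gis_elem \<Rightarrow> 'r::ring"
  assumes central: "central_map G \<delta>" and eq: "cl_equiv G p q"
  shows "\<delta> (gis_path G p) = \<delta> (gis_path G q)" "\<delta> (gis_star G p) = \<delta> (gis_star G q)"
proof -
  obtain x y where xy: "x \<in> Path G" "y \<in> Path G" "path_range G x = fst y" "path_range G y = fst x"
    and pq: "p = path_concat x y" "q = path_concat y x"
    using eq by (auto simp: cl_equiv_iff)
  have m: "gis_path G x \<in> gis G" "gis_path G y \<in> gis G" "gis_star G x \<in> gis G" "gis_star G y \<in> gis G"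
    using xy gis_path_mem gis_star_mem by auto
  show "\<delta> (gis_path G p) = \<delta> (gis_path G q)" "\<delta> (gis_star G p) = \<delta> (gis_star G q)"
    using central m unfolding pq central_map_def
    by (simp_all add: gis_path_path[symmetric] gis_star_star[symmetric] xy)
qed

end

theorem proposition19:
  fixes E :: "('v, 'e) pre_digraph"
    and \<delta> :: "('v, 'e) gis_elem \<Rightarrow> 'r::ring"
  assumes "wf_digraph E"
    and "preserves_zero E \<delta>"
  shows "central_map E \<delta> \<longleftrightarrow>
    (\<forall>x \<in> gis E. \<delta> x \<noteq> 0 \<longrightarrow>
       (\<exists>p \<in> Path E. \<exists>q \<in> ClPath E.
          x = gis_mult E (gis_mult E (gis_path E p) (gis_path E q)) (gis_star E p) \<or>
          x = gis_mult E (gis_mult E (gis_path E p) (gis_star E q)) (gis_star E p))) \<and>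
    (\<forall>p \<in> Path E. \<forall>q \<in> ClPath E. path_range E p = path_source q \<longrightarrow>
       \<delta> (gis_mult E (gis_mult E (gis_path E p) (gis_path E q)) (gis_star E p))
         = \<delta> (gis_path E q) \<and>
       \<delta> (gis_mult E (gis_mult E (gis_path E p) (gis_star E q)) (gis_star E p))
         = \<delta> (gis_star E q)) \<and>
    (\<forall>p \<in> ClPath E. \<forall>q \<in> ClPath E. cl_equiv E p q \<longrightarrow>
       \<delta> (gis_path E p) = \<delta> (gis_path E q) \<and>
       \<delta> (gis_star E p) = \<delta> (gis_star E q))"
proof -
  interpret wf_digraph E by fact
  have zero: "\<delta> (gis_zero E) = 0" using assms(2) by (simp add: preserves_zero_def)
  show ?thesis
  proof (rule iffI, goal_cases)
    case 1
    then have "central_map E \<delta>" .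
    then show ?case unfolding path_source_def
      by (intro conjI ballI impI central_map_support[of \<delta>, OF zero]
          central_map_conj[of \<delta>] central_map_rot[of \<delta>])
  next
    case 2
    then show ?case using central_map_of_conditions[of \<delta>, OF zero] by blast
  qed
qed

end
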